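(* Every randomized algorithm that, given an $n\times n$ matrix $M$, decides whether $M$ has a (non-strict) saddlepoint and returns its value, correctly with probability at least $5/6$ on every input, must query in expectation $\Omega(n^2)$ entries of $M$, for some $n\times n$ matrix $M$.
   Context: A saddlepoint of a matrix is an entry that is the maximum of its row and the minimum of its column (not necessarily strictly). The algorithm accesses the matrix only by querying (reading) entries. *)

theory Defs
  imports "HOL-Probability.Probability" "Jordan_Normal_Form.Matrix"
begin

definition saddlepoint :: "real mat \<Rightarrow> nat \<Rightarrow> nat \<Rightarrow> bool" where
  "saddlepoint A i j \<longleftrightarrow>
     i < dim_row A \<and> j < dim_col A \<and>
     (\<forall>j'<dim_col A. A $$ (i, j') \<le> A $$ (i, j)) \<and>
     (\<forall>i'<dim_row A. A $$ (i, j) \<le> A $$ (i', j))"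

text \<open>A deterministic query algorithm: the continuation of \<open>Query i j k\<close> depends on the value read
  at position \<open>(i, j)\<close>. Being a codatatype, it includes algorithms that do not terminate on some
  inputs. \<open>Answer None\<close> claims that there is no saddlepoint, \<open>Answer (Some v)\<close> that there is one,
  of value \<open>v\<close>.\<close>

codatatype det_alg = Answer "real option" | Query nat nat "real \<Rightarrow> det_alg"

inductive outputs :: "real mat \<Rightarrow> det_alg \<Rightarrow> real option \<Rightarrow> bool" for A where
  outputs_Answer: "outputs A (Answer r) r"
| outputs_Query: "outputs A (k (A $$ (i, j))) r \<Longrightarrow> outputs A (Query i j k) r"

text \<open>\<open>in_queried A t p\<close>: the run of \<open>t\<close> on input \<open>A\<close>, terminating or not, reads position \<open>p\<close>.\<close>

inductive in_queried :: "real mat \<Rightarrow> det_alg \<Rightarrow> nat \<times> nat \<Rightarrow> bool" for A where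
  in_queried_here: "in_queried A (Query i j k) (i, j)"
| in_queried_later: "in_queried A (k (A $$ (i, j))) p \<Longrightarrow> in_queried A (Query i j k) p"

definition queried :: "real mat \<Rightarrow> det_alg \<Rightarrow> (nat \<times> nat) set" where
  "queried A t = {p. in_queried A t p}"

text \<open>A randomized algorithm is a probability distribution on deterministic algorithms. The
  \<open>\<sigma>\<close>-algebra is arbitrary, subject to the set of positions read and the answer being random
  variables on every input.\<close>

definition randomized_alg :: "nat \<Rightarrow> det_alg measure \<Rightarrow> bool" where
  "randomized_alg n R \<longleftrightarrow>
     prob_space R \<and>
     (\<forall>A \<in> carrier_mat n n.
        (\<forall>t \<in> space R. queried A t \<subseteq> {..<n} \<times> {..<n}) \<and>
        queried A \<in> measurable R (count_space UNIV) \<and>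
        (\<forall>r. {t \<in> space R. outputs A t r} \<in> sets R))"

definition correct_answer :: "real mat \<Rightarrow> real option \<Rightarrow> bool" where
  "correct_answer A r \<longleftrightarrow>
     (case r of
        None \<Rightarrow> \<not> (\<exists>i j. saddlepoint A i j)
      | Some v \<Rightarrow> (\<exists>i j. saddlepoint A i j \<and> A $$ (i, j) = v))"

definition decides_saddlepoint :: "nat \<Rightarrow> real \<Rightarrow> det_alg measure \<Rightarrow> bool" where
  "decides_saddlepoint n p R \<longleftrightarrow>
     (\<forall>A \<in> carrier_mat n n.
        measure R {t \<in> space R. \<exists>r. outputs A t r \<and> correct_answer A r} \<ge> p)"

text \<open>Repeated reads of the same entry are counted once, so a lower bound on this quantity also
  bounds the expected number of read operations.\<close>

definition expected_queries :: "det_alg measure \<Rightarrow> real mat \<Rightarrow> real" where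
  "expected_queries R A = (\<integral>t. real (card (queried A t)) \<partial>R)"

end

theory Submission
  imports Defs
begin

text \<open>
  A 0/1 matrix has a saddlepoint iff it has a zero row or an all-one column. Take matrices with
  exactly one 1 per row and no all-one column, and compare such a matrix \<open>M\<^sub>j\<close>, whose 1 in row \<open>i\<close>
  is in column \<open>j\<close>, with the matrix \<open>B\<close> in which row \<open>i\<close> is zero. The algorithm must tell them
  apart, so it reads \<open>(i, j)\<close> on input \<open>B\<close> with probability at least \<open>2/3\<close>; hence it reads both
  \<open>(i, j)\<close> and \<open>(i, j')\<close> on \<open>B\<close> with probability at least \<open>1/3\<close>. Whichever of the two is read
  first on \<open>B\<close> is also read when the other one is changed to 1. So
  \<open>P[M\<^sub>j' reads (i, j)] + P[M\<^sub>j reads (i, j')] \<ge> 1/3\<close>, and averaging over all columns \<open>j, j'\<close> and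
  all positions of the 1s in the other rows gives at least \<open>n/6\<close> expected reads per row.
\<close>

section \<open>Runs of a single deterministic algorithm on nearby inputs\<close>

lemma outputs_deterministic:
  assumes "outputs A t r" "outputs A t r'"
  shows "r = r'"
  using assms by (induction) (auto elim: outputs.cases)

lemma outputs_cong_queried:
  assumes "outputs B t r" "\<And>x. in_queried B t x \<Longrightarrow> A $$ x = B $$ x"
  shows "outputs A t r"
  using assms
proof induction
  case (outputs_Query k i j r)
  have "outputs A (k (B $$ (i, j))) r"
    using outputs_Query by (blast intro: in_queried_later)
  moreover have "A $$ (i, j) = B $$ (i, j)"
    using outputs_Query.prems in_queried_here by blast
  ultimately show ?case
    by (metis outputs.outputs_Query)
qed (rule outputs_Answer)

text \<open>Up to the first read of \<open>p\<close> or \<open>q\<close>, the runs on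
  \<open>B\<close>, \<open>A\<close> and \<open>A'\<close> coincide. If \<open>q\<close> comes
  first, \<open>A\<close> leads there too, since it may differ from \<open>B\<close> only at
  \<open>p\<close>; symmetrically for \<open>p\<close> and \<open>A'\<close>.\<close>

lemma in_queried_first:
  assumes "in_queried B t p" "in_queried B t q"
    and "\<And>x. in_queried B t x \<Longrightarrow> x \<noteq> p \<Longrightarrow> A $$ x = B $$ x"
    and "\<And>x. in_queried B t x \<Longrightarrow> x \<noteq> q \<Longrightarrow> A' $$ x = B $$ x"
  shows "in_queried A t q \<or> in_queried A' t p"
  using assms
proof induction
  case (in_queried_here i j k)
  then show ?case
    by (blast intro: in_queried.in_queried_here)
next
  case (in_queried_later k i j p)
  show ?case
  proof (cases "(i, j) = p \<or> (i, j) = q")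
    case True
    then show ?thesis by (blast intro: in_queried.in_queried_here)
  next
    case False
    have "in_queried B (k (B $$ (i, j))) q"
      using in_queried_later.prems(1) False by (auto elim: in_queried.cases)
    then have "in_queried A (k (B $$ (i, j))) q \<or> in_queried A' (k (B $$ (i, j))) p"
      using in_queried_later by (blast intro: in_queried.in_queried_later)
    moreover have "A $$ (i, j) = B $$ (i, j)" "A' $$ (i, j) = B $$ (i, j)"
      using in_queried_later.prems(2,3) False in_queried_here by blast+
    ultimately show ?thesis
      by (metis in_queried.in_queried_later)
  qed
qed

section \<open>The hard inputs\<close>

text \<open>A value \<open>\<tau> i \<ge> n\<close> makes row \<open>i\<close> zero.\<close>

definition row_unit_mat :: "nat \<Rightarrow> (nat \<Rightarrow> nat) \<Rightarrow> real mat" where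
  "row_unit_mat n \<tau> = mat n n (\<lambda>(i, j). if j = \<tau> i then 1 else 0)"

lemma row_unit_mat_carrier [simp]: "row_unit_mat n \<tau> \<in> carrier_mat n n"
  and row_unit_mat_dim [simp]: "dim_row (row_unit_mat n \<tau>) = n" "dim_col (row_unit_mat n \<tau>) = n"
  and row_unit_mat_index [simp]:
    "i < n \<Longrightarrow> j < n \<Longrightarrow> row_unit_mat n \<tau> $$ (i, j) = (if j = \<tau> i then 1 else 0)"
  by (auto simp: row_unit_mat_def)

lemma row_unit_mat_no_saddlepoint:
  assumes "2 \<le> n" "\<tau> 0 \<noteq> \<tau> 1" "\<And>k. k < n \<Longrightarrow> \<tau> k < n"
  shows "\<not> saddlepoint (row_unit_mat n \<tau>) i j"
proof
  assume s: "saddlepoint (row_unit_mat n \<tau>) i j"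
  then have i: "i < n" and j: "j < n"
    by (auto simp: saddlepoint_def)
  have "row_unit_mat n \<tau> $$ (i, \<tau> i) \<le> row_unit_mat n \<tau> $$ (i, j)"
    using s i assms(3) by (simp add: saddlepoint_def del: row_unit_mat_index)
  then have "j = \<tau> i"
    using i j assms(3) by (auto split: if_splits)
  \<comment> \<open>The entry is 1 and minimal in its column, so the whole column is 1.\<close>
  then have "j = \<tau> k" if "k < n" for k
    using s i j that by (fastforce simp: saddlepoint_def split: if_splits)
  from this[of 0] this[of 1] assms(1,2) show False by simp
qed

lemma row_unit_mat_saddlepoint:
  assumes "i < n" "n \<le> \<tau> i"
  shows "saddlepoint (row_unit_mat n \<tau>) i 0"
  using assms by (auto simp: saddlepoint_def)

text \<open>Each function in \<open>PiE I J\<close> arises as \<open>\<sigma>(i := j)\<close> once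
  for every overwritten value \<open>\<sigma> i\<close>: resampling one coordinate preserves the
  uniform distribution.\<close>

lemma sum_PiE_resample:
  fixes G :: "('a \<Rightarrow> 'b) \<Rightarrow> real"
  assumes "i \<in> I"
  shows "(\<Sum>\<sigma>\<in>PiE I J. \<Sum>j\<in>J i. G (\<sigma>(i := j))) = real (card (J i)) * (\<Sum>\<sigma>\<in>PiE I J. G \<sigma>)"
proof -
  let ?K = "PiE (I - {i}) J"
  have I: "I = insert i (I - {i})"
    using assms by blast
  have eq: "(\<Sum>\<sigma>\<in>PiE I J. H \<sigma>) = (\<Sum>(y, f)\<in>J i \<times> ?K. H (f(i := y)))" for H :: "_ \<Rightarrow> real"
    by (subst I, subst PiE_insert_eq, subst sum.reindex)
      (auto intro!: inj_combinator simp: case_prod_beta)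
  show ?thesis
    unfolding eq by (simp add: sum.cartesian_product[symmetric]) (rule disjI2, rule sum.swap)
qed

section \<open>Read probabilities of a randomized algorithm\<close>

context
  fixes n :: nat and R :: "det_alg measure"
  assumes R: "randomized_alg n R"
begin

interpretation prob_space R
  using R by (simp add: randomized_alg_def)

lemma in_queried_bounded:
  "A \<in> carrier_mat n n \<Longrightarrow> t \<in> space R \<Longrightarrow> in_queried A t x \<Longrightarrow> x \<in> {..<n} \<times> {..<n}"
  using R unfolding randomized_alg_def queried_def by blast

lemma in_queried_event [measurable]:
  assumes "A \<in> carrier_mat n n"
  shows "{t \<in> space R. in_queried A t x} \<in> events"
proof -
  have "queried A \<in> measurable R (count_space UNIV)"
    using R assms by (simp add: randomized_alg_def)
  from measurable_sets[OF this, of "{S. x \<in> S}"] show ?thesis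
    by (simp add: queried_def vimage_def Int_def conj_commute)
qed

lemma expected_queries_eq_sum:
  assumes A: "A \<in> carrier_mat n n"
  shows "expected_queries R A = (\<Sum>x\<in>{..<n} \<times> {..<n}. prob {t \<in> space R. in_queried A t x})"
proof -
  have "real (card (queried A t)) =
      (\<Sum>x\<in>{..<n} \<times> {..<n}. indicator {t \<in> space R. in_queried A t x} t)" if "t \<in> space R" for t
  proof -
    have "queried A t = {x \<in> {..<n} \<times> {..<n}. t \<in> {t \<in> space R. in_queried A t x}}"
      using in_queried_bounded[OF A that] that by (auto simp: queried_def)
    then show ?thesis
      by (simp add: indicator_def sum.If_cases Int_def)
  qed
  then have "expected_queries R A =
      (\<integral>t. (\<Sum>x\<in>{..<n} \<times> {..<n}. indicator {t \<in> space R. in_queried A t x} t) \<partial>R)"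
    unfolding expected_queries_def by (intro Bochner_Integration.integral_cong) auto
  also have "\<dots> = (\<Sum>x\<in>{..<n} \<times> {..<n}. prob {t \<in> space R. in_queried A t x})"
    using in_queried_event[OF A]
    by (subst Bochner_Integration.integral_sum) (auto simp: integrable_indicator_iff emeasure_eq_measure)
  finally show ?thesis .
qed

lemma prob_Int_ge:
  assumes "E \<in> events" "F \<in> events"
  shows "prob (E \<inter> F) \<ge> prob E + prob F - 1"
  using finite_measure_Union'[OF assms] prob_le_1[of "E \<union> F"] finite_measure_Diff'[OF assms(2,1)]
  by (simp add: Int_commute)

context
  fixes \<tau> :: "nat \<Rightarrow> nat" and i :: nat
  assumes decides: "decides_saddlepoint n (5 / 6) R"
    and n: "2 \<le> n" and \<tau>: "\<And>k. k < n \<Longrightarrow> \<tau> k < n" "\<tau> 0 \<noteq> \<tau> 1"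
    and i: "2 \<le> i" "i < n"
begin

abbreviation "filled j \<equiv> row_unit_mat n (\<tau>(i := j))"
abbreviation "cleared \<equiv> row_unit_mat n (\<tau>(i := n))"

text \<open>Being read on \<open>cleared\<close> places \<open>x\<close> inside the matrix; entries
  outside are unspecified.\<close>

lemma filled_eq_cleared:
  assumes "t \<in> space R" "in_queried cleared t x" "x \<noteq> (i, j)"
  shows "filled j $$ x = cleared $$ x"
proof -
  have "x \<in> {..<n} \<times> {..<n}"
    using in_queried_bounded assms(1,2) by (meson row_unit_mat_carrier)
  then show ?thesis
    using assms(3) by (auto split: if_splits)
qed

lemma prob_in_queried_cleared:
  assumes j: "j < n"
  shows "prob {t \<in> space R. in_queried cleared t (i, j)} \<ge> 2 / 3"
proof -
  define S where "S A = {t \<in> space R. \<exists>r. outputs A t r \<and> correct_answer A r}" for A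
  have S: "prob (S A) \<ge> 5 / 6" "S A \<in> events" if "A \<in> carrier_mat n n" for A
  proof -
    show *: "prob (S A) \<ge> 5 / 6"
      using decides that by (simp add: decides_saddlepoint_def S_def)
    show "S A \<in> events"
      \<comment> \<open>A set that is not an event would have measure 0.\<close>
      using * measure_notin_sets[of "S A" R] by fastforce
  qed
  have "in_queried cleared t (i, j)" if tS: "t \<in> S (filled j)" "t \<in> S cleared" for t
  proof (rule ccontr)
    assume nq: "\<not> in_queried cleared t (i, j)"
    have t: "t \<in> space R"
      using tS by (simp add: S_def)
    \<comment> \<open>Since \<open>2 \<le> i\<close>, rows 0 and 1 keep their 1s in different
      columns.\<close>
    have "\<not> saddlepoint (filled j) k l" for k l
      using n \<tau> i j by (intro row_unit_mat_no_saddlepoint) auto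
    then have "outputs (filled j) t None"
      using tS(1) by (auto simp: S_def correct_answer_def split: option.splits)
    moreover have "saddlepoint cleared i 0"
      using i by (intro row_unit_mat_saddlepoint) auto
    then obtain v where v: "outputs cleared t (Some v)"
      using tS(2) by (auto simp: S_def correct_answer_def split: option.splits)
    have "outputs (filled j) t (Some v)"
      by (rule outputs_cong_queried[OF v], rule filled_eq_cleared[OF t]) (use nq in auto)
    ultimately show False
      using outputs_deterministic by blast
  qed
  then have "prob (S (filled j) \<inter> S cleared) \<le> prob {t \<in> space R. in_queried cleared t (i, j)}"
    by (intro finite_measure_mono in_queried_event) (auto simp: S_def)
  then show ?thesis
    using prob_Int_ge[OF S(2) S(2), of "filled j" cleared] S(1)[of "filled j"] S(1)[of cleared]
    by simp
qed

text \<open>The constant is \<open>2/3 + 2/3 - 1\<close>. The diagonal case \<open>j = j'\<close> is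
  included, so the later sum runs over all pairs.\<close>

lemma prob_in_queried_filled:
  assumes j: "j < n" "j' < n"
  shows "prob {t \<in> space R. in_queried (filled j) t (i, j')}
       + prob {t \<in> space R. in_queried (filled j') t (i, j)} \<ge> 1 / 3"
proof -
  let ?Q = "\<lambda>A l. {t \<in> space R. in_queried A t (i, l)}"
  have "?Q cleared j \<inter> ?Q cleared j' \<subseteq> ?Q (filled j) j' \<union> ?Q (filled j') j"
    using in_queried_first[of cleared _ "(i, j)" "(i, j')" "filled j" "filled j'"]
      filled_eq_cleared by blast
  then have "prob (?Q cleared j \<inter> ?Q cleared j') \<le> prob (?Q (filled j) j' \<union> ?Q (filled j') j)"
    by (intro finite_measure_mono) auto
  also have "\<dots> \<le> prob (?Q (filled j) j') + prob (?Q (filled j') j)"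
    by (intro measure_Un_le) auto
  finally show ?thesis
    using prob_Int_ge[of "?Q cleared j" "?Q cleared j'"]
      prob_in_queried_cleared[OF j(1)] prob_in_queried_cleared[OF j(2)]
    by simp
qed

end

section \<open>Averaging over the hard inputs\<close>

lemma exists_expected_queries_ge:
  assumes decides: "decides_saddlepoint n (5 / 6) R" and n: "2 \<le> n"
  shows "\<exists>A \<in> carrier_mat n n. expected_queries R A \<ge> real (n - 2) * (real n / 6)"
proof (rule ccontr)
  \<comment> \<open>Rows 0 and 1 are frozen with distinct columns, which rules out an all-one
    column; the other rows are free.\<close>
  define J where "J i = (if i = 0 then {0} else if i = 1 then {1} else {..<n})" for i :: nat
  define T where "T = PiE {..<n} J"
  define F where "F \<tau> i j = prob {t \<in> space R. in_queried (row_unit_mat n \<tau>) t (i, j)}" for \<tau> i j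
  assume "\<not> ?thesis"
  then have less: "expected_queries R (row_unit_mat n \<tau>) < real (n - 2) * (real n / 6)" for \<tau>
    by (meson not_le row_unit_mat_carrier)
  have T: "finite T" "T \<noteq> {}"
    using n by (auto simp: T_def J_def PiE_eq_empty_iff intro!: finite_PiE)
  have T_D: "\<tau> k < n" "\<tau> 0 \<noteq> \<tau> 1" if "\<tau> \<in> T" "k < n" for \<tau> k
  proof -
    have "\<tau> m \<in> J m" if "m < n" for m
      using \<open>\<tau> \<in> T\<close> that by (auto simp: T_def)
    from this[of k] this[of 0] this[of 1] that n show "\<tau> k < n" "\<tau> 0 \<noteq> \<tau> 1"
      by (auto simp: J_def split: if_splits)
  qed
  have row: "(\<Sum>\<tau>\<in>T. \<Sum>j<n. F \<tau> i j) \<ge> card T * (real n / 6)" if i: "i \<in> {2..<n}" for i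
  proof -
    have "n * (n / 3) \<le> 2 * (\<Sum>j'<n. \<Sum>j<n. F (\<tau>(i := j')) i j)" if \<tau>: "\<tau> \<in> T" for \<tau>
    proof -
      have "n * (n / 3) = (\<Sum>j'<n. \<Sum>j<n. 1 / 3 :: real)"
        by simp
      also have "\<dots> \<le> (\<Sum>j'<n. \<Sum>j<n. F (\<tau>(i := j')) i j + F (\<tau>(i := j)) i j')"
        unfolding F_def using i T_D[OF \<tau>] n decides
        by (intro sum_mono prob_in_queried_filled) auto
      also have "\<dots> = (\<Sum>j'<n. \<Sum>j<n. F (\<tau>(i := j')) i j) + (\<Sum>j'<n. \<Sum>j<n. F (\<tau>(i := j)) i j')"
        by (simp add: sum.distrib)
      \<comment> \<open>Exchanging the roles of \<open>j\<close> and \<open>j'\<close> identifies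
        the two halves; this factor 2 turns \<open>1/3\<close> into \<open>1/6\<close>.\<close>
      also have "(\<Sum>j'<n. \<Sum>j<n. F (\<tau>(i := j)) i j') = (\<Sum>j'<n. \<Sum>j<n. F (\<tau>(i := j')) i j)"
        by (rule sum.swap)
      finally show ?thesis
        by linarith
    qed
    then have "(\<Sum>\<tau>\<in>T. n * (n / 3)) \<le> (\<Sum>\<tau>\<in>T. 2 * (\<Sum>j'<n. \<Sum>j<n. F (\<tau>(i := j')) i j))"
      by (rule sum_mono)
    also have "\<dots> = 2 * (\<Sum>\<tau>\<in>T. \<Sum>j'<n. \<Sum>j<n. F (\<tau>(i := j')) i j)"
      by (simp add: sum_distrib_left)
    \<comment> \<open>Row \<open>i\<close> is free, so overwriting its 1 uniformly only contributes
      the factor \<open>card (J i) = n\<close>.\<close>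
    also have "(\<Sum>\<tau>\<in>T. \<Sum>j'<n. \<Sum>j<n. F (\<tau>(i := j')) i j) = n * (\<Sum>\<tau>\<in>T. \<Sum>j<n. F \<tau> i j)"
      using sum_PiE_resample[of i "{..<n}" "\<lambda>\<tau>. \<Sum>j<n. F \<tau> i j" J] i
      by (simp add: T_def J_def)
    finally have "n * (card T * (real n / 6)) \<le> n * (\<Sum>\<tau>\<in>T. \<Sum>j<n. F \<tau> i j)"
      by (simp add: field_simps)
    then show ?thesis
      using n by (subst (asm) mult_le_cancel_left_pos) auto
  qed
  have "card T * (real (n - 2) * (real n / 6)) = (\<Sum>i=2..<n. card T * (real n / 6))"
    by simp
  also have "\<dots> \<le> (\<Sum>i=2..<n. \<Sum>\<tau>\<in>T. \<Sum>j<n. F \<tau> i j)"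
    using row by (rule sum_mono)
  also have "\<dots> \<le> (\<Sum>i<n. \<Sum>\<tau>\<in>T. \<Sum>j<n. F \<tau> i j)"
    by (intro sum_mono2) (auto simp: F_def intro!: sum_nonneg)
  also have "\<dots> = (\<Sum>\<tau>\<in>T. expected_queries R (row_unit_mat n \<tau>))"
    by (subst sum.swap) (simp add: expected_queries_eq_sum sum.cartesian_product F_def case_prod_beta)
  also have "\<dots> < (\<Sum>\<tau>\<in>T. real (n - 2) * (real n / 6))"
    using T less by (intro sum_strict_mono) auto
  finally show False
    by simp
qed

end

theorem theorem15:
  "\<exists>c::real. c > 0 \<and>
     (\<forall>\<^sub>F n in sequentially.
        \<forall>R. randomized_alg n R \<and> decides_saddlepoint n (5 / 6) R \<longrightarrow>
          (\<exists>A \<in> carrier_mat n n. expected_queries R A \<ge> c * (real n)\<^sup>2))"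
proof (intro exI[of _ "1 / 12"] conjI eventually_sequentiallyI[of 4] allI impI)
  fix n R
  assume n: "4 \<le> (n::nat)" and "randomized_alg n R \<and> decides_saddlepoint n (5 / 6) R"
  then obtain A where A: "A \<in> carrier_mat n n" "expected_queries R A \<ge> real (n - 2) * (real n / 6)"
    using exists_expected_queries_ge[of n R] by auto
  \<comment> \<open>From \<open>n \<ge> 4\<close> on, \<open>n - 2 \<ge> n / 2\<close>, which gives
    the constant \<open>1/2 * 1/6\<close>.\<close>
  have "1 / 12 * (real n)\<^sup>2 = real n / 2 * (real n / 6)"
    by (simp add: power2_eq_square)
  also have "\<dots> \<le> real (n - 2) * (real n / 6)"
    using n by (intro mult_right_mono) auto
  finally show "\<exists>A \<in> carrier_mat n n. expected_queries R A \<ge> 1 / 12 * (real n)\<^sup>2"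
    using A by (intro bexI[of _ A]) auto
qed simp

end
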